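(* Let $N\ge2$ and consider the adiabatic search Hamiltonian $H(s)$ with the interpolation $$f(s)=\frac12\left[1+\frac1{\sqrt{N-1}}\tan\!\Big((2s-1)\arctan\sqrt{N-1}\Big)\right].$$ For $T>0$ let $\Psi(s,T)$ solve $\frac{i\hbar}{T}\partial_s\Psi=H(s)\Psi$ with $\Psi(0,T)=|\sigma\rangle$, and let $\varepsilon(T)=\arccos|\langle m|\Psi(1,T)\rangle|$. Then, for fixed $N$ and $T\to\infty$, $$\varepsilon(T)\le\frac{\hbar}{\mathsf E T}\,2\arccos\big(1/\sqrt N\big)+O\!\left(\frac1{T^2}\right).$$ Moreover, for every constant $C>0$, the validity time $T_{\rm val}$ and validity error $\tilde\varepsilon$ associated with this interpolation (defined in the context) are $$T_{\rm val}=\frac{\hbar}{\mathsf E}\,C\,\arccos\big(1/\sqrt N\big)\sqrt{N-1},\qquad \tilde\varepsilon=\frac{2}{C\sqrt{N-1}}.$$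
   Context: Adiabatic search: $\hbar,\mathsf E>0$ are constants; $|0\rangle,\dots,|N-1\rangle$ is an orthonormal basis of $\mathbb C^N$, $|m\rangle$ is one of these basis vectors (the marked item), $|\sigma\rangle=N^{-1/2}\sum_x|x\rangle$, and $$H(s)=\mathsf E\big[(1-f(s))(1-|\sigma\rangle\langle\sigma|)+f(s)(1-|m\rangle\langle m|)\big],\quad s\in[0,1],$$ where $f$ is monotonically increasing with $f(0)=0$, $f(1)=1$. The span of $|\sigma\rangle,|m\rangle$ is invariant. Let $|m_\perp\rangle=\sqrt{\tfrac{N}{N-1}}\,(|\sigma\rangle-N^{-1/2}|m\rangle)$. On this subspace $H(s)/\mathsf E$ has eigenvalues $\frac12(1\mp\Delta(s))$ with $$\Delta(s)=\sqrt{1-4\tfrac{N-1}{N}f(s)(1-f(s))},$$ and eigenvectors $\phi_0=\sin\frac\theta2|m\rangle+\cos\frac\theta2|m_\perp\rangle$ (lower eigenvalue) and $\phi_1=\cos\frac\theta2|m\rangle-\sin\frac\theta2|m_\perp\rangle$, where $\theta(s)\in[0,\pi]$ and $\cos\theta(s)=\big(2\frac{N-1}{N}(1-f(s))-1\big)/\Delta(s)$. So $\phi_0(0)=|\sigma\rangle$, $\phi_0(1)=|m\rangle$. Put $\lambda_{10}(s)=\langle\phi_1(s),\dot\phi_0(s)\rangle/\Delta(s)$ and $J_0(1)=\int_0^1|\langle\phi_1(s),\dot\phi_0(s)\rangle|^2/\Delta(s)\,ds$ (dot $=d/ds$). For a constant $C>0$ the validity time and validity error of the leading-order relation are defined by $$T_{\rm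 val}=\frac{\hbar}{\mathsf E}\,C\left|J_0(1)+\frac{\dot\lambda_{10}(1)}{\lambda_{10}(1)}\right|,\qquad\tilde\varepsilon=\frac{\hbar}{\mathsf E\,T_{\rm val}}\,2|\lambda_{10}(1)|.$$ *)

theory Defs
  imports "HOL-Analysis.Analysis" "HOL-Library.Landau_Symbols"
begin

text \<open>The state space \<open>\<complex>\<^sup>N\<close> is \<open>complex ^ 'n\<close> with \<open>N = CARD('n)\<close>.
  The library's \<open>inner\<close> on this type is only the real part of the Hermitian inner product,
  so the latter is introduced here (conjugate-linear in the first argument).\<close>

definition braket :: "complex ^ 'n \<Rightarrow> complex ^ 'n \<Rightarrow> complex" where
  "braket u v = (\<Sum>i\<in>UNIV. cnj (u $ i) * v $ i)"

definition ketbra :: "complex ^ 'n \<Rightarrow> complex ^ 'n \<Rightarrow> complex ^ 'n ^ 'n" where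
  "ketbra u v = (\<chi> i j. u $ i * cnj (v $ j))"

text \<open>An orthonormal family indexed by \<open>'n\<close> has \<open>N\<close> members, hence is a basis.\<close>

definition orthonormal_basis :: "('n \<Rightarrow> complex ^ 'n) \<Rightarrow> bool" where
  "orthonormal_basis e \<longleftrightarrow> (\<forall>x y. braket (e x) (e y) = (if x = y then 1 else 0))"

definition uniform_state :: "('n \<Rightarrow> complex ^ 'n) \<Rightarrow> complex ^ 'n" where
  "uniform_state e = (1 / sqrt (real CARD('n))) *\<^sub>R (\<Sum>x\<in>UNIV. e x)"

definition marked_perp :: "('n \<Rightarrow> complex ^ 'n) \<Rightarrow> 'n \<Rightarrow> complex ^ 'n" where
  "marked_perp e m = sqrt (real CARD('n) / (real CARD('n) - 1)) *\<^sub>R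
     (uniform_state e - (1 / sqrt (real CARD('n))) *\<^sub>R e m)"

definition search_hamiltonian ::
  "real \<Rightarrow> ('n \<Rightarrow> complex ^ 'n) \<Rightarrow> 'n \<Rightarrow> (real \<Rightarrow> real) \<Rightarrow> real \<Rightarrow> complex ^ 'n ^ 'n" where
  "search_hamiltonian E e m f s = E *\<^sub>R
     ((1 - f s) *\<^sub>R (mat 1 - ketbra (uniform_state e) (uniform_state e)) +
      f s *\<^sub>R (mat 1 - ketbra (e m) (e m)))"

text \<open>The scaled time \<open>s\<close> lives in \<open>[0,1]\<close>; here and below all derivatives with respect to \<open>s\<close>
  are taken within this interval, so they are one-sided at the end points.\<close>

definition schroedinger_solution ::
  "real \<Rightarrow> real \<Rightarrow> (real \<Rightarrow> complex ^ 'n ^ 'n) \<Rightarrow> (real \<Rightarrow> complex ^ 'n) \<Rightarrow> bool" where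
  "schroedinger_solution hbar T H \<psi> \<longleftrightarrow>
     (\<forall>s\<in>{0..1}. \<exists>D. (\<psi> has_vector_derivative D) (at s within {0..1}) \<and>
        (\<i> * of_real (hbar / T)) *s D = H s *v \<psi> s)"

definition gap :: "nat \<Rightarrow> (real \<Rightarrow> real) \<Rightarrow> real \<Rightarrow> real" where
  "gap N f s = sqrt (1 - 4 * ((real N - 1) / real N) * f s * (1 - f s))"

definition mixing_angle :: "nat \<Rightarrow> (real \<Rightarrow> real) \<Rightarrow> real \<Rightarrow> real" where
  "mixing_angle N f s = arccos ((2 * ((real N - 1) / real N) * (1 - f s) - 1) / gap N f s)"

definition phi0 :: "('n \<Rightarrow> complex ^ 'n) \<Rightarrow> 'n \<Rightarrow> (real \<Rightarrow> real) \<Rightarrow> real \<Rightarrow> complex ^ 'n" where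
  "phi0 e m f s = sin (mixing_angle CARD('n) f s / 2) *\<^sub>R e m +
                  cos (mixing_angle CARD('n) f s / 2) *\<^sub>R marked_perp e m"

definition phi1 :: "('n \<Rightarrow> complex ^ 'n) \<Rightarrow> 'n \<Rightarrow> (real \<Rightarrow> real) \<Rightarrow> real \<Rightarrow> complex ^ 'n" where
  "phi1 e m f s = cos (mixing_angle CARD('n) f s / 2) *\<^sub>R e m -
                  sin (mixing_angle CARD('n) f s / 2) *\<^sub>R marked_perp e m"

definition coupling :: "('n \<Rightarrow> complex ^ 'n) \<Rightarrow> 'n \<Rightarrow> (real \<Rightarrow> real) \<Rightarrow> real \<Rightarrow> complex" where
  "coupling e m f s = braket (phi1 e m f s) (vector_derivative (phi0 e m f) (at s within {0..1}))"

definition lambda10 :: "('n \<Rightarrow> complex ^ 'n) \<Rightarrow> 'n \<Rightarrow> (real \<Rightarrow> real) \<Rightarrow> real \<Rightarrow> complex" where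
  "lambda10 e m f s = coupling e m f s / of_real (gap CARD('n) f s)"

definition J0_final :: "('n \<Rightarrow> complex ^ 'n) \<Rightarrow> 'n \<Rightarrow> (real \<Rightarrow> real) \<Rightarrow> real" where
  "J0_final e m f = integral {0..1} (\<lambda>s. (cmod (coupling e m f s))\<^sup>2 / gap CARD('n) f s)"

definition validity_time ::
  "real \<Rightarrow> real \<Rightarrow> real \<Rightarrow> ('n \<Rightarrow> complex ^ 'n) \<Rightarrow> 'n \<Rightarrow> (real \<Rightarrow> real) \<Rightarrow> real" where
  "validity_time hbar E C e m f = hbar / E * C *
     cmod (of_real (J0_final e m f) +
           vector_derivative (lambda10 e m f) (at 1 within {0..1}) / lambda10 e m f 1)"

definition validity_error ::
  "real \<Rightarrow> real \<Rightarrow> real \<Rightarrow> ('n \<Rightarrow> complex ^ 'n) \<Rightarrow> 'n \<Rightarrow> (real \<Rightarrow> real) \<Rightarrow> real" where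
  "validity_error hbar E C e m f =
     hbar / (E * validity_time hbar E C e m f) * (2 * cmod (lambda10 e m f 1))"

definition tan_interpolation :: "nat \<Rightarrow> real \<Rightarrow> real" where
  "tan_interpolation N s =
     1 / 2 * (1 + 1 / sqrt (real N - 1) * tan ((2 * s - 1) * arctan (sqrt (real N - 1))))"

end

theory Submission imports Defs begin

text \<open>
  Put \<open>\<alpha> = arccos (1 / \<surd>N)\<close>, \<open>u = (2 s - 1) \<alpha>\<close> and \<open>\<kappa> = T E / \<hbar>\<close>. The tangent schedule is the one for
  which the mixing angle is linear, \<open>\<theta> = \<pi> - 2 \<alpha> (1 - s)\<close>; the coupling is then the constant \<open>\<alpha>\<close>
  and the gap is \<open>cos \<alpha> / cos u\<close>, so the validity quantities are elementary integrals and derivatives.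
  Up to a common phase the amplitudes \<open>G\<close>, \<open>B\<close> along the two eigenvectors satisfy
  \<open>B' = - \<alpha> G\<close> and \<open>G' = \<alpha> B + \<i> \<kappa> \<Delta> G\<close>. Integrating by parts twice and using that the gap
  equals 1 at both ends, \<open>\<bar>B(1)\<bar> \<le> 2 \<alpha> / \<kappa> + O(1 / \<kappa>\<^sup>2)\<close>. Since \<open>\<bar>G(1)\<bar> = \<bar>\<langle>m, \<Psi>(1)\<rangle>\<bar>\<close>, the
  error is \<open>arcsin \<bar>B(1)\<bar>\<close>, which differs from \<open>\<bar>B(1)\<bar>\<close> only in second order.
\<close>

section \<open>Transitions in a two-level system\<close>

text \<open>A mean value point need not exist for vector-valued \<open>f\<close>, so the inequality
  comes from integrating the derivative.\<close>

lemma norm_diff_le_vector_derivative_bound: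
  fixes f :: "real \<Rightarrow> 'a::banach"
  assumes "a \<le> b"
    and "\<And>s. s \<in> {a..b} \<Longrightarrow> (f has_vector_derivative f' s) (at s within {a..b})"
    and "\<And>s. s \<in> {a..b} \<Longrightarrow> norm (f' s) \<le> c" and "0 \<le> c"
  shows "norm (f b - f a) \<le> c * (b - a)"
  using has_integral_bound[of c f' "f b - f a" a b]
    fundamental_theorem_of_calculus[of a b f f'] assms
  by simp

lemma le_one_if_sum_squares_eq_one:
  fixes x y :: real
  assumes "x\<^sup>2 + y\<^sup>2 = 1"
  shows "x \<le> 1" "y \<le> 1"
proof -
  have "x\<^sup>2 \<le> 1" "y\<^sup>2 \<le> 1"
    using assms zero_le_power2[of x] zero_le_power2[of y] by linarith+
  thus "x \<le> 1" "y \<le> 1" by (auto simp: abs_square_le_1)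
qed

text \<open>Since \<open>b\<close> is the sine of the angle \<open>arccos a\<close>, the angle is at
  most its tangent \<open>b / a\<close>, which exceeds \<open>b\<close> only to second order. The
  constant 8 is large enough that for \<open>b > 1/2\<close> the square term alone exceeds
  \<open>pi / 2\<close>.\<close>

lemma arccos_le_if_sum_squares_eq_one:
  fixes a b :: real
  assumes "0 \<le> a" "0 \<le> b" "a\<^sup>2 + b\<^sup>2 = 1"
  shows "arccos a \<le> b + 8 * b\<^sup>2"
proof (cases "b \<le> 1/2")
  case True
  have b2: "b\<^sup>2 \<le> 1/4" using power_mono[OF True assms(2), of 2] by (simp add: power2_eq_square)
  have a1: "a \<le> 1" by (rule le_one_if_sum_squares_eq_one[OF assms(3)])
  \<comment> \<open>From \<open>a \<ge> a\<^sup>2 = 1 - b\<^sup>2 \<ge> 3/4\<close> the quotient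
    \<open>b / a\<close> stays under control; the same inequality later gives
    \<open>1 - a \<le> b\<^sup>2\<close>.\<close>
  have "a * a \<le> a" using a1 assms(1) by (simp add: mult_left_le)
  hence a34: "a \<ge> 3/4" using assms(3) b2 unfolding power2_eq_square by linarith
  have range: "0 \<le> arccos a" "arccos a < pi/2"
    using arccos_lbound[of a] arccos_less_arccos[of 0 a] a1 a34 by auto
  have sinb: "sin (arccos a) = b"
  proof -
    have "b = sqrt (1 - a\<^sup>2)" using assms by (intro real_sqrt_unique[symmetric]) auto
    thus ?thesis using a1 a34 by (simp add: sin_arccos)
  qed
  have "arccos a \<le> tan (arccos a)"
    using arctan_le_self[of "tan (arccos a)"] arctan_tan[of "arccos a"] range
    by (cases "arccos a = 0") (auto simp: tan_gt_zero less_imp_le)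
  also have "tan (arccos a) = b / a" using sinb a1 a34 by (simp add: tan_def)
  also have "\<dots> \<le> b + 8 * b\<^sup>2"
  proof -
    have "b * (1 - a) \<le> b * (8 * b * a)"
    proof (intro mult_left_mono)
      have "1 - a \<le> b\<^sup>2" using \<open>a * a \<le> a\<close> assms(3) unfolding power2_eq_square by linarith
      also have "\<dots> \<le> b" using True assms(2) by (simp add: power2_eq_square mult_left_le)
      also have "b \<le> b * (8 * a)" using mult_left_mono[of 1 "8 * a" b] a34 assms(2) by simp
      finally show "1 - a \<le> 8 * b * a" by (simp add: mult_ac)
    qed (use assms in auto)
    thus ?thesis using a34 by (simp add: field_simps power2_eq_square)
  qed
  finally show ?thesis .
next
  case False
  have "a \<le> 1" by (rule le_one_if_sum_squares_eq_one[OF assms(3)])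
  hence "arccos a \<le> pi/2" using arccos_le_arccos[of 0 a] assms(1) by auto
  also have "\<dots> \<le> 2" using pi_less_4 by simp
  also have "2 \<le> 8 * b\<^sup>2" using power_mono[of "1/2" b 2] False by (simp add: power2_eq_square)
  finally show ?thesis using assms(2) by simp
qed

text \<open>The coefficient matrix is skew-Hermitian: the entries \<open>\<alpha>\<close> and
  \<open>- \<alpha>\<close> are antisymmetric and \<open>\<i> * q s\<close> is imaginary. The
  squared norm therefore has derivative zero.\<close>

lemma two_level_norm_conserved:
  fixes G B :: "real \<Rightarrow> complex" and q :: "real \<Rightarrow> real"
  assumes dB: "\<And>s. s \<in> {0..1} \<Longrightarrow>
      (B has_vector_derivative - of_real \<alpha> * G s) (at s within {0..1})"
    and dG: "\<And>s. s \<in> {0..1} \<Longrightarrow>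
      (G has_vector_derivative of_real \<alpha> * B s + \<i> * of_real (q s) * G s) (at s within {0..1})"
    and "s \<in> {0..1}"
  shows "(cmod (B s))\<^sup>2 + (cmod (G s))\<^sup>2 = (cmod (B 0))\<^sup>2 + (cmod (G 0))\<^sup>2"
proof -
  have "((\<lambda>s. B s \<bullet> B s + G s \<bullet> G s) has_derivative (\<lambda>h. 0)) (at x within {0..1})"
    if "x \<in> {0..1}" for x
  proof -
    note dBx = dB[OF that, unfolded has_vector_derivative_def]
    note dGx = dG[OF that, unfolded has_vector_derivative_def]
    show ?thesis
      by (rule has_derivative_eq_rhs[OF has_derivative_add
            [OF has_derivative_inner[OF dBx dBx] has_derivative_inner[OF dGx dGx]]])
        (auto simp: fun_eq_iff inner_complex_def algebra_simps)
  qed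
  hence "\<exists>c. \<forall>x\<in>{0..1}. B x \<bullet> B x + G x \<bullet> G x = c"
    by (intro has_derivative_zero_constant) auto
  then obtain c where "\<And>x. x \<in> {0..1} \<Longrightarrow> B x \<bullet> B x + G x \<bullet> G x = c" by blast
  from this[of s] this[of 0] assms(3) show ?thesis
    by (simp add: power2_norm_eq_inner)
qed

text \<open>Here \<open>p\<close> is the reciprocal of the gap, and \<open>M\<close> bounds
  \<open>p\<close> and its first two derivatives. \<open>G\<close> oscillates at rate
  \<open>\<kappa> / p\<close>, so the integral of \<open>- \<alpha> * G\<close> reduces to boundary
  terms of size \<alpha> / \<kappa>, one per end point, and a second-order remainder.\<close>

lemma two_level_transition_bound:
  fixes G B :: "real \<Rightarrow> complex" and p p1 p2 :: "real \<Rightarrow> real"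
  assumes \<alpha>: "\<alpha> > 0" and \<kappa>: "\<kappa> > 0"
    and dB: "\<And>s. s \<in> {0..1} \<Longrightarrow>
      (B has_vector_derivative - of_real \<alpha> * G s) (at s within {0..1})"
    and dG: "\<And>s. s \<in> {0..1} \<Longrightarrow>
      (G has_vector_derivative of_real \<alpha> * B s + \<i> * of_real (\<kappa> / p s) * G s)
        (at s within {0..1})"
    and dp: "\<And>s. s \<in> {0..1} \<Longrightarrow> (p has_real_derivative p1 s) (at s within {0..1})"
    and dp1: "\<And>s. s \<in> {0..1} \<Longrightarrow> (p1 has_real_derivative p2 s) (at s within {0..1})"
    and p_pos: "\<And>s. s \<in> {0..1} \<Longrightarrow> 0 < p s"
    and p_le: "\<And>s. s \<in> {0..1} \<Longrightarrow> p s \<le> M"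
    and p1_le: "\<And>s. s \<in> {0..1} \<Longrightarrow> \<bar>p1 s\<bar> \<le> M"
    and p2_le: "\<And>s. s \<in> {0..1} \<Longrightarrow> \<bar>p2 s\<bar> \<le> M"
    and ends: "p 0 = 1" "p 1 = 1" and init: "B 0 = 0" "cmod (G 0) = 1"
  shows "cmod (B 1) \<le> 2 * \<alpha> / \<kappa> + \<alpha> * M\<^sup>2 * (\<alpha>\<^sup>2 * (3 + \<alpha>) + 4 + \<alpha>) / \<kappa>\<^sup>2"
proof -
  have norm1: "(cmod (B s))\<^sup>2 + (cmod (G s))\<^sup>2 = 1" if "s \<in> {0..1}" for s
    using two_level_norm_conserved[of B \<alpha> G "\<lambda>s. \<kappa> / p s" s] dB dG that init by simp
  have B1: "cmod (B s) \<le> 1" and G1: "cmod (G s) \<le> 1" if "s \<in> {0..1}" for s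
    by (rule le_one_if_sum_squares_eq_one[OF norm1[OF that]])+
  have M: "M \<ge> 1" using p_le[of 0] ends by simp
  \<comment> \<open>\<open>G = p (G' - \<alpha> B) / (\<i> \<kappa>)\<close> turns \<open>B' = - \<alpha> G\<close> into a total derivative plus a remainder
    with one factor \<open>1 / \<kappa>\<close>; applying this once gives \<open>Q\<close>, twice gives \<open>Q - R\<close>, whose
    derivative is of order \<open>1 / \<kappa>\<^sup>2\<close> because \<open>B\<close> itself is of order \<open>1 / \<kappa>\<close>.\<close>
  define \<mu> where "\<mu> = of_real \<alpha> / (\<i> * of_real \<kappa>)"
  have \<mu>: "cmod \<mu> = \<alpha> / \<kappa>" "\<mu> * \<i> * of_real \<kappa> = of_real \<alpha>"
    using \<alpha> \<kappa> by (auto simp: \<mu>_def norm_mult norm_divide)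
  define Q where "Q = (\<lambda>s. B s + \<mu> * (of_real (p s) * G s))"
  define Q' where "Q' = (\<lambda>s. \<mu> * (of_real (p1 s) * G s + of_real \<alpha> * of_real (p s) * B s))"
  have dQ: "(Q has_vector_derivative Q' s) (at s within {0..1})" if s: "s \<in> {0..1}" for s
  proof -
    \<comment> \<open>Multiplying by \<open>p\<close> removes the gap from the oscillating term; as
      \<open>\<mu> * \<i> * \<kappa> = \<alpha>\<close>, that term then cancels
      \<open>- \<alpha> * G s\<close>, the only part of the derivative of \<open>Q\<close> without a
      factor \<open>\<mu>\<close>.\<close>
    have cancel: "of_real (p s) * (\<i> * of_real (\<kappa> / p s) * G s) = \<i> * of_real \<kappa> * G s"
      using p_pos[OF s] by simp
    have "(Q has_vector_derivative - of_real \<alpha> * G s + \<mu> * (of_real (p s) *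
        (of_real \<alpha> * B s + \<i> * of_real (\<kappa> / p s) * G s) + of_real (p1 s) * G s)) (at s within {0..1})"
      unfolding Q_def
      by (intro has_vector_derivative_add has_vector_derivative_mult_right has_vector_derivative_mult
          has_vector_derivative_of_real dB[OF s] dG[OF s]
          dp[OF s])
    also have "- of_real \<alpha> * G s + \<mu> * (of_real (p s) *
        (of_real \<alpha> * B s + \<i> * of_real (\<kappa> / p s) * G s) + of_real (p1 s) * G s) = Q' s"
      unfolding distrib_left[of "of_real (p s)"] cancel Q'_def
      using \<mu>(2) by (simp add: algebra_simps)
    finally show ?thesis .
  qed
  have p1G: "cmod (of_real (p1 s) * G s) \<le> M" and pB: "cmod (of_real (p s) * B s) \<le> M * cmod (B s)"
    and pG: "cmod (of_real (p s) * G s) \<le> M" if s: "s \<in> {0..1}" for s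
    using mult_mono[OF p1_le[OF s] G1[OF s]] mult_mono[OF p_le[OF s] G1[OF s]]
      mult_right_mono[OF p_le[OF s], of "cmod (B s)"] p_pos[OF s] M by (auto simp: norm_mult)
  have Q'_le: "cmod (Q' s) \<le> \<alpha> / \<kappa> * (M + \<alpha> * M)" if s: "s \<in> {0..1}" for s
  proof -
    have "cmod (of_real (p s) * B s) \<le> M"
      using order_trans[OF pB[OF s] mult_left_le[OF B1[OF s]]] M by simp
    hence "cmod (of_real \<alpha> * (of_real (p s) * B s)) \<le> \<alpha> * M"
      unfolding norm_mult[of "of_real \<alpha>"] norm_of_real using \<alpha> by simp
    hence "cmod (of_real (p1 s) * G s + of_real \<alpha> * (of_real (p s) * B s)) \<le> M + \<alpha> * M"
      by (intro norm_triangle_mono p1G[OF s])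
    thus ?thesis unfolding Q'_def using \<alpha> \<kappa>
      by (simp only: norm_mult \<mu>(1)) (intro mult_left_mono, auto simp: mult_ac)
  qed
  \<comment> \<open>First-order bound at every \<open>s\<close>, needed because the remainder
    contains \<open>B\<close>. In \<open>3 + \<alpha>\<close>, the part \<open>1 + \<alpha>\<close>
    comes from \<open>Q'\<close> and 2 from the boundary terms at 0 and \<open>s\<close>.\<close>
  have B_le: "cmod (B s) \<le> \<alpha> / \<kappa> * (M * (3 + \<alpha>))" if s: "s \<in> {0..1}" for s
  proof -
    have "cmod (Q s - Q 0) \<le> \<alpha> / \<kappa> * (M + \<alpha> * M) * (s - 0)"
    proof (rule norm_diff_le_vector_derivative_bound)
      show "(Q has_vector_derivative Q' t) (at t within {0..s})" if "t \<in> {0..s}" for t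
        using dQ[of t] that s by (auto intro: has_vector_derivative_within_subset)
      show "cmod (Q' t) \<le> \<alpha> / \<kappa> * (M + \<alpha> * M)" if "t \<in> {0..s}" for t
        using Q'_le[of t] that s by auto
    qed (use s \<alpha> \<kappa> M in auto)
    also have "\<dots> \<le> \<alpha> / \<kappa> * (M + \<alpha> * M)"
      using s \<alpha> \<kappa> M by (intro mult_left_le) auto
    finally have 1: "cmod (Q s - Q 0) \<le> \<alpha> / \<kappa> * (M + \<alpha> * M)" .
    have 2: "cmod (\<mu> * (of_real (p t) * G t)) \<le> \<alpha> / \<kappa> * M" if "t \<in> {0..1}" for t
      unfolding norm_mult[of \<mu>] \<mu>(1) using pG[OF that] \<alpha> \<kappa> by (intro mult_left_mono) auto
    have "B s = (Q s - Q 0) + (\<mu> * (of_real (p 0) * G 0) - \<mu> * (of_real (p s) * G s))"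
      using init by (simp add: Q_def)
    also have "cmod \<dots> \<le> \<alpha> / \<kappa> * (M + \<alpha> * M) + (\<alpha> / \<kappa> * M + \<alpha> / \<kappa> * M)"
      using s by (intro norm_triangle_mono order_trans[OF norm_triangle_ineq4] add_mono 1 2) auto
    finally show ?thesis by (simp add: algebra_simps)
  qed
  define R where "R = (\<lambda>s. \<mu> / (\<i> * of_real \<kappa>) * (of_real (p s * p1 s) * G s))"
  define R' where "R' = (\<lambda>s. \<mu> / (\<i> * of_real \<kappa>) *
     (of_real (p s * p2 s + p1 s * p1 s) * G s + of_real \<alpha> * of_real (p s * p1 s) * B s))"
  have \<mu>\<kappa>: "cmod (\<mu> / (\<i> * of_real \<kappa>)) = \<alpha> / \<kappa>\<^sup>2"
    using \<mu>(1) \<kappa> by (simp add: norm_divide norm_mult power2_eq_square)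
  have dR: "(R has_vector_derivative R' s + \<mu> * (of_real (p1 s) * G s)) (at s within {0..1})"
    if s: "s \<in> {0..1}" for s
  proof -
    have cancel: "of_real (p s * p1 s) * (\<i> * of_real (\<kappa> / p s) * G s)
        = \<i> * of_real \<kappa> * (of_real (p1 s) * G s)"
      using p_pos[OF s] by simp
    have "((\<lambda>s. p s * p1 s) has_real_derivative p s * p2 s + p1 s * p1 s) (at s within {0..1})"
      by (rule DERIV_cong[OF DERIV_mult[OF dp[OF s] dp1[OF s]]]) simp
    hence "(R has_vector_derivative \<mu> / (\<i> * of_real \<kappa>) * (of_real (p s * p1 s) *
        (of_real \<alpha> * B s + \<i> * of_real (\<kappa> / p s) * G s)
         + of_real (p s * p2 s + p1 s * p1 s) * G s)) (at s within {0..1})"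
      unfolding R_def
      by (intro has_vector_derivative_mult_right has_vector_derivative_mult dG s has_vector_derivative_of_real)
    also have "\<mu> / (\<i> * of_real \<kappa>) * (of_real (p s * p1 s) *
        (of_real \<alpha> * B s + \<i> * of_real (\<kappa> / p s) * G s)
         + of_real (p s * p2 s + p1 s * p1 s) * G s) = R' s + \<mu> * (of_real (p1 s) * G s)"
      unfolding distrib_left[of "of_real (p s * p1 s)"] cancel R'_def
      using \<kappa> by (simp add: field_simps)
    finally show ?thesis .
  qed
  have pp1: "\<bar>p s * p1 s\<bar> \<le> M * M" and pp2: "\<bar>p s * p2 s + p1 s * p1 s\<bar> \<le> M * M + M * M"
    if s: "s \<in> {0..1}" for s
  proof -
    have "\<bar>x * y\<bar> \<le> M * M" if "\<bar>x\<bar> \<le> M" "\<bar>y\<bar> \<le> M" for x y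
      unfolding abs_mult using that M by (intro mult_mono) auto
    note prod = this
    have "\<bar>p s\<bar> \<le> M" using p_le[OF s] p_pos[OF s] by simp
    with prod p1_le[OF s] p2_le[OF s]
    have 1: "\<bar>p s * p1 s\<bar> \<le> M * M" and "\<bar>p s * p2 s\<bar> \<le> M * M" "\<bar>p1 s * p1 s\<bar> \<le> M * M"
      by blast+
    thus "\<bar>p s * p1 s\<bar> \<le> M * M" "\<bar>p s * p2 s + p1 s * p1 s\<bar> \<le> M * M + M * M"
      by (auto intro: order_trans[OF abs_triangle_ineq])
  qed
  have R_le: "cmod (R s) \<le> \<alpha> / \<kappa>\<^sup>2 * M\<^sup>2" if s: "s \<in> {0..1}" for s
  proof -
    have "cmod (of_real (p s * p1 s) * G s) \<le> M * M * 1"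
      unfolding norm_mult norm_of_real using pp1[OF s] G1[OF s] M by (intro mult_mono) auto
    thus ?thesis unfolding R_def norm_mult[of "\<mu> / (\<i> * of_real \<kappa>)"] \<mu>\<kappa> power2_eq_square[of M]
      using \<alpha> by (intro mult_left_mono) auto
  qed
  have R'_le: "cmod (R' s) \<le> \<alpha> / \<kappa>\<^sup>2 * ((2 + \<alpha>) * M\<^sup>2)" if s: "s \<in> {0..1}" for s
  proof -
    have "cmod (of_real (p s * p2 s + p1 s * p1 s) * G s) \<le> (M * M + M * M) * 1"
      unfolding norm_mult[of _ "G s"] norm_of_real using pp2[OF s] G1[OF s] M by (intro mult_mono) auto
    moreover have "cmod (of_real \<alpha> * of_real (p s * p1 s) * B s) \<le> \<alpha> * (M * M) * 1"
      unfolding norm_mult[of _ "B s"] norm_mult[of "of_real \<alpha>"] norm_of_real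
      using pp1[OF s] B1[OF s] M \<alpha> by (intro mult_mono) auto
    ultimately have "cmod (of_real (p s * p2 s + p1 s * p1 s) * G s
        + of_real \<alpha> * of_real (p s * p1 s) * B s) \<le> (M * M + M * M) * 1 + \<alpha> * (M * M) * 1"
      by (rule norm_triangle_mono)
    also have "\<dots> = (2 + \<alpha>) * M\<^sup>2" by (simp add: algebra_simps power2_eq_square)
    finally show ?thesis unfolding R'_def norm_mult[of "\<mu> / (\<i> * of_real \<kappa>)"] \<mu>\<kappa>
      using \<alpha> by (intro mult_left_mono) auto
  qed
  \<comment> \<open>The terms \<open>\<mu> * p1 * G\<close> cancel in the derivative of
    \<open>Q - R\<close>. What is left is a multiple of \<open>\<mu> * p * B\<close>, second order
    by \<open>B_le\<close>, and \<open>R'\<close>.\<close>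
  have "cmod ((Q 1 - R 1) - (Q 0 - R 0))
      \<le> (\<alpha> / \<kappa>\<^sup>2 * (\<alpha>\<^sup>2 * M\<^sup>2 * (3 + \<alpha>)) + \<alpha> / \<kappa>\<^sup>2 * ((2 + \<alpha>) * M\<^sup>2)) * (1 - 0)"
  proof (rule norm_diff_le_vector_derivative_bound)
    fix s :: real assume s: "s \<in> {0..1}"
    show "((\<lambda>s. Q s - R s) has_vector_derivative
        \<mu> * (of_real \<alpha> * (of_real (p s) * B s)) - R' s) (at s within {0..1})"
      using has_vector_derivative_diff[OF dQ[OF s] dR[OF s]]
      by (simp add: Q'_def algebra_simps)
    have "cmod (of_real (p s) * B s) \<le> M * (\<alpha> / \<kappa> * (M * (3 + \<alpha>)))"
      using M by (intro order_trans[OF pB[OF s]] mult_left_mono B_le s) auto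
    hence "cmod (\<mu> * (of_real \<alpha> * (of_real (p s) * B s)))
        \<le> \<alpha> / \<kappa> * (\<alpha> * (M * (\<alpha> / \<kappa> * (M * (3 + \<alpha>)))))"
      unfolding norm_mult[of \<mu>] norm_mult[of "of_real \<alpha>"] \<mu>(1) norm_of_real abs_of_pos[OF \<alpha>]
      using \<alpha> \<kappa> by (intro mult_left_mono divide_nonneg_pos) auto
    also have "\<dots> = \<alpha> / \<kappa>\<^sup>2 * (\<alpha>\<^sup>2 * M\<^sup>2 * (3 + \<alpha>))"
      by (simp add: power2_eq_square)
    finally show "cmod (\<mu> * (of_real \<alpha> * (of_real (p s) * B s)) - R' s)
        \<le> \<alpha> / \<kappa>\<^sup>2 * (\<alpha>\<^sup>2 * M\<^sup>2 * (3 + \<alpha>)) + \<alpha> / \<kappa>\<^sup>2 * ((2 + \<alpha>) * M\<^sup>2)"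
      by (intro order_trans[OF norm_triangle_ineq4] add_mono R'_le s)
  qed (use \<alpha> \<kappa> M in auto)
  \<comment> \<open>The leading term 2 \<alpha> / \<kappa>: the boundary values of
    \<open>\<mu> * p * G\<close>, with \<open>p = 1\<close> at both ends.\<close>
  moreover have "cmod (\<mu> * G 0 - \<mu> * G 1) \<le> \<alpha> / \<kappa> + \<alpha> / \<kappa>"
    unfolding \<mu>(1)[symmetric] using G1[of 0] G1[of 1]
    by (intro order_trans[OF norm_triangle_ineq4] add_mono)
      (auto simp: norm_mult intro!: mult_left_le)
  moreover have "cmod (R 1 - R 0) \<le> \<alpha> / \<kappa>\<^sup>2 * M\<^sup>2 + \<alpha> / \<kappa>\<^sup>2 * M\<^sup>2"
    by (intro order_trans[OF norm_triangle_ineq4] add_mono R_le) auto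
  moreover have "B 1 = ((Q 1 - R 1) - (Q 0 - R 0)) + ((\<mu> * G 0 - \<mu> * G 1) + (R 1 - R 0))"
    using init ends by (simp add: Q_def)
  ultimately have "cmod (B 1) \<le> (\<alpha> / \<kappa>\<^sup>2 * (\<alpha>\<^sup>2 * M\<^sup>2 * (3 + \<alpha>)) + \<alpha> / \<kappa>\<^sup>2 * ((2 + \<alpha>) * M\<^sup>2)) * (1 - 0)
      + ((\<alpha> / \<kappa> + \<alpha> / \<kappa>) + (\<alpha> / \<kappa>\<^sup>2 * M\<^sup>2 + \<alpha> / \<kappa>\<^sup>2 * M\<^sup>2))"
    by (metis norm_triangle_mono)
  thus ?thesis by (simp add: algebra_simps add_divide_distrib)
qed

section \<open>The Hermitian product and the search Hamiltonian\<close>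

lemma braket_simps:
  shows braket_add_right: "braket u (v + w) = braket u v + braket u w"
    and braket_diff_right: "braket u (v - w) = braket u v - braket u w"
    and braket_scaleR_right: "braket u (r *\<^sub>R v) = of_real r * braket u v"
    and braket_smult_right: "braket u (z *s v) = z * braket u v"
    and braket_add_left: "braket (u + v) w = braket u w + braket v w"
    and braket_diff_left: "braket (u - v) w = braket u w - braket v w"
    and braket_scaleR_left: "braket (r *\<^sub>R u) v = of_real r * braket u v"
  by (simp_all add: braket_def algebra_simps sum.distrib sum_subtractf sum_distrib_left
      scaleR_conv_of_real[where 'a = complex])

lemma braket_sum_right: "braket u (\<Sum>x\<in>A. g x) = (\<Sum>x\<in>A. braket u (g x))"
  unfolding braket_def sum_component sum_distrib_left by (rule sum.swap)

lemma braket_commute: "braket v u = cnj (braket u v)"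
  by (simp add: braket_def mult.commute)

text \<open>Lets vector derivatives of a state pass to its amplitudes.\<close>

lemma bounded_linear_braket: "bounded_linear (braket u)"
  unfolding linear_conv_bounded_linear[symmetric]
  by (rule linearI) (simp_all add: braket_simps scaleR_conv_of_real[where 'a = complex])

lemma ketbra_mult_vec: "ketbra u v *v w = braket v w *s u"
  by (simp add: vec_eq_iff ketbra_def braket_def matrix_vector_mult_def sum_distrib_left
      mult_ac)

lemma scaleR_matrix_mult_vec: "(r *\<^sub>R A) *v w = r *\<^sub>R (A *v w)"
  for A :: "complex ^ 'n ^ 'm"
  by (simp add: vec_eq_iff matrix_vector_mult_def scaleR_sum_right)

lemma search_hamiltonian_mult_vec:
  "search_hamiltonian E e m f s *v w =
     E *\<^sub>R ((1 - f s) *\<^sub>R (w - braket (uniform_state e) w *s uniform_state e) +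
           f s *\<^sub>R (w - braket (e m) w *s e m))"
  unfolding search_hamiltonian_def
  by (simp only: scaleR_matrix_mult_vec matrix_vector_mult_add_rdistrib
      matrix_vector_mult_diff_rdistrib matrix_vector_mul_lid ketbra_mult_vec)

section \<open>The tangent schedule\<close>

text \<open>The angle between the uniform and the marked state, that is
  \<open>arccos (1 / sqrt N)\<close> for \<open>N \<ge> 2\<close>. The arctangent form matches the
  argument of the tangent in \<open>tan_interpolation\<close>.\<close>

definition search_angle :: "nat \<Rightarrow> real" where
  "search_angle N = arctan (sqrt (real N - 1))"

context
  fixes N :: nat
  assumes N: "N \<ge> 2"
begin

lemma search_angle_bounds: "0 < search_angle N" "search_angle N < pi / 2"
  using N arctan_ubound by (auto simp: search_angle_def)

lemma cos_search_angle: "cos (search_angle N) = 1 / sqrt N"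
  using N by (simp add: search_angle_def cos_arctan)

lemma sin_search_angle: "sin (search_angle N) = sqrt (real N - 1) / sqrt N"
  using N by (simp add: search_angle_def sin_arctan)

lemma cos_search_angle_pos: "cos (search_angle N) > 0"
  using N by (simp add: cos_search_angle)

lemma sin_search_angle_pos: "sin (search_angle N) > 0"
  using N by (simp add: sin_search_angle)

lemma tan_search_angle: "tan (search_angle N) = sqrt (real N - 1)"
  by (simp add: search_angle_def tan_arctan)

lemma arccos_search_angle: "arccos (1 / sqrt N) = search_angle N"
  using arccos_cos[of "search_angle N"] search_angle_bounds by (simp add: cos_search_angle)

text \<open>The argument lies in [-\<alpha>, \<alpha>] with \<alpha> < pi/2, and cosine is even and
  decreasing on [0, pi]. This keeps the denominators below positive.\<close>

lemma cos_scaled_angle_ge: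
  assumes "s \<in> {0..1}"
  shows "cos (search_angle N) \<le> cos ((2 * s - 1) * search_angle N)"
proof -
  have "\<bar>(2 * s - 1) * search_angle N\<bar> \<le> 1 * search_angle N"
    unfolding abs_mult using assms search_angle_bounds by (intro mult_mono) auto
  hence "cos (search_angle N) \<le> cos \<bar>(2 * s - 1) * search_angle N\<bar>"
    using search_angle_bounds by (intro cos_monotone_0_pi_le) auto
  thus ?thesis by simp
qed

lemma cos_scaled_angle_pos:
  assumes "s \<in> {0..1}"
  shows "cos ((2 * s - 1) * search_angle N) > 0"
  using cos_scaled_angle_ge[OF assms] cos_search_angle_pos by linarith

text \<open>The addition formula for sine puts \<open>1 + tan u / tan \<alpha>\<close> over one
  denominator. Together with its mirror image under \<open>u\<close> to \<open>-u\<close>, this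
  product form makes the schedule times its complement easy to simplify.\<close>

lemma tan_interpolation_eq:
  assumes "s \<in> {0..1}"
  defines "u \<equiv> (2 * s - 1) * search_angle N"
  shows "tan_interpolation N s = sin (search_angle N + u) / (2 * sin (search_angle N) * cos u)"
proof -
  have "tan_interpolation N s = 1 / 2 * (1 + 1 / tan (search_angle N) * tan u)"
    unfolding tan_interpolation_def tan_search_angle u_def by (simp add: search_angle_def)
  also have "\<dots> = sin (search_angle N + u) / (2 * sin (search_angle N) * cos u)"
    using cos_search_angle_pos sin_search_angle_pos cos_scaled_angle_pos[OF assms(1), folded u_def]
    by (simp add: tan_def sin_add field_simps)
  finally show ?thesis .
qed

lemma one_minus_tan_interpolation_eq:
  assumes "s \<in> {0..1}"
  defines "u \<equiv> (2 * s - 1) * search_angle N"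
  shows "1 - tan_interpolation N s = sin (search_angle N - u) / (2 * sin (search_angle N) * cos u)"
  using cos_search_angle_pos sin_search_angle_pos cos_scaled_angle_pos[OF assms(1), folded u_def]
  unfolding tan_interpolation_eq[OF assms(1), folded u_def]
  by (simp add: sin_add sin_diff field_simps)

text \<open>With \<open>(N - 1) / N = (sin \<alpha>)\<^sup>2\<close> and \<open>sin (\<alpha> + u) *
  sin (\<alpha> - u) = (cos u)\<^sup>2 - (cos \<alpha>)\<^sup>2\<close>, the radicand becomes a
  perfect square.\<close>

lemma gap_tan_interpolation:
  assumes "s \<in> {0..1}"
  shows "gap N (tan_interpolation N) s = cos (search_angle N) / cos ((2 * s - 1) * search_angle N)"
proof -
  define \<alpha> where "\<alpha> = search_angle N"
  define u where "u = (2 * s - 1) * \<alpha>"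
  have pos: "sin \<alpha> > 0" "cos u > 0" "cos \<alpha> > 0"
    using sin_search_angle_pos cos_scaled_angle_pos[OF assms] cos_search_angle_pos
    by (auto simp: \<alpha>_def u_def)
  have sin2: "(real N - 1) / real N = (sin \<alpha>)\<^sup>2"
    using N by (simp add: \<alpha>_def sin_search_angle power_divide)
  have ff: "tan_interpolation N s * (1 - tan_interpolation N s)
      = sin (\<alpha> + u) * sin (\<alpha> - u) / (4 * (sin \<alpha>)\<^sup>2 * (cos u)\<^sup>2)"
    using arg_cong2[OF tan_interpolation_eq[OF assms] one_minus_tan_interpolation_eq[OF assms], of "(*)"]
    unfolding \<alpha>_def[symmetric] u_def[symmetric] by (simp add: power2_eq_square)
  have "1 - 4 * ((real N - 1) / real N) * tan_interpolation N s * (1 - tan_interpolation N s)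
      = 1 - sin (\<alpha> + u) * sin (\<alpha> - u) / (cos u)\<^sup>2"
    unfolding sin2 mult.assoc ff using pos by simp
  also have "\<dots> = (cos \<alpha> / cos u)\<^sup>2"
  proof -
    have "sin (\<alpha> + u) * sin (\<alpha> - u) = (cos u)\<^sup>2 - (cos \<alpha>)\<^sup>2"
      using sin_cos_squared_add[of \<alpha>] sin_cos_squared_add[of u]
      unfolding sin_add sin_diff by algebra
    thus ?thesis using pos by (simp add: field_simps)
  qed
  finally show ?thesis
    unfolding gap_def \<alpha>_def[symmetric] u_def[symmetric] using pos by simp
qed

text \<open>Expanding \<open>u\<close> as \<open>\<alpha> - (\<alpha> - u)\<close> collapses the
  cosine of the mixing angle to \<open>- cos (\<alpha> - u)\<close>, and \<open>\<alpha> - u\<close>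
  is linear in \<open>s\<close>.\<close>

lemma mixing_angle_tan_interpolation:
  assumes "s \<in> {0..1}"
  shows "mixing_angle N (tan_interpolation N) s = pi - 2 * (search_angle N * (1 - s))"
proof -
  define \<alpha> where "\<alpha> = search_angle N"
  define u where "u = (2 * s - 1) * \<alpha>"
  have pos: "sin \<alpha> > 0" "cos u > 0" "cos \<alpha> > 0"
    using sin_search_angle_pos cos_scaled_angle_pos[OF assms] cos_search_angle_pos
    by (auto simp: \<alpha>_def u_def)
  have sin2: "(real N - 1) / real N = (sin \<alpha>)\<^sup>2"
    using N by (simp add: \<alpha>_def sin_search_angle power_divide)
  have "(2 * ((real N - 1) / real N) * (1 - tan_interpolation N s) - 1)
      / gap N (tan_interpolation N) s = (sin \<alpha> * sin (\<alpha> - u) - cos u) / cos \<alpha>"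
    unfolding sin2 one_minus_tan_interpolation_eq[OF assms] gap_tan_interpolation[OF assms]
      \<alpha>_def[symmetric] u_def[symmetric]
    using pos by (simp add: field_simps power2_eq_square)
  also have "sin \<alpha> * sin (\<alpha> - u) - cos u = - cos \<alpha> * cos (\<alpha> - u)"
    using sin_cos_squared_add[of \<alpha>] unfolding sin_diff cos_diff by algebra
  also have "- cos \<alpha> * cos (\<alpha> - u) / cos \<alpha> = cos (pi - (\<alpha> - u))"
    using pos by simp
  finally have "mixing_angle N (tan_interpolation N) s = arccos (cos (pi - (\<alpha> - u)))"
    unfolding mixing_angle_def by simp
  also have "\<dots> = pi - (\<alpha> - u)"
  proof (rule arccos_cos)
    \<comment> \<open>Since \<alpha> < pi/2, the angle
      \<open>\<alpha> - u = 2 * (\<alpha> * (1 - s))\<close> stays in [0, pi], the range where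
      \<open>arccos\<close> inverts \<open>cos\<close>.\<close>
    have "\<alpha> * (1 - s) \<le> \<alpha>" "0 \<le> \<alpha> * (1 - s)"
      using assms search_angle_bounds mult_left_le[of "1 - s" \<alpha>] by (auto simp: \<alpha>_def)
    moreover have "\<alpha> - u = 2 * (\<alpha> * (1 - s))" by (simp add: u_def algebra_simps)
    ultimately show "0 \<le> pi - (\<alpha> - u)" "pi - (\<alpha> - u) \<le> pi"
      using search_angle_bounds unfolding \<alpha>_def[symmetric] by linarith+
  qed
  finally show ?thesis by (simp add: \<alpha>_def u_def algebra_simps)
qed

end

section \<open>Eigenvectors and validity quantities\<close>

context
  fixes e :: "'n::finite \<Rightarrow> complex ^ 'n" and m :: 'n and N :: nat and \<alpha> :: real
  defines "N \<equiv> CARD('n)" and "\<alpha> \<equiv> search_angle N"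
  assumes basis: "orthonormal_basis e" and N: "N \<ge> 2"
begin

lemma braket_marked_marked: "braket (e m) (e m) = 1"
  using basis by (simp add: orthonormal_basis_def)

lemma braket_basis_uniform: "braket (e x) (uniform_state e) = of_real (cos \<alpha>)"
  using basis cos_search_angle[OF N]
  by (simp add: uniform_state_def braket_scaleR_right braket_sum_right orthonormal_basis_def
      \<alpha>_def N_def)

lemma braket_uniform_basis: "braket (uniform_state e) (e x) = of_real (cos \<alpha>)"
  using braket_commute[of "uniform_state e" "e x"] by (simp add: braket_basis_uniform)

lemma braket_uniform_uniform: "braket (uniform_state e) (uniform_state e) = 1"
proof -
  have "braket (uniform_state e) (uniform_state e)
      = of_real (1 / sqrt N) * (\<Sum>x\<in>UNIV. braket (uniform_state e) (e x))"
    by (subst (2) uniform_state_def) (simp only: braket_scaleR_right braket_sum_right N_def)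
  also have "\<dots> = of_real (1 / sqrt N * (real N * (1 / sqrt N)))"
    unfolding braket_uniform_basis \<alpha>_def cos_search_angle[OF N]
    by (simp add: N_def field_simps flip: of_real_mult)
  also have "1 / sqrt N * (real N * (1 / sqrt N)) = 1" using N by (simp add: field_simps)
  finally show ?thesis by simp
qed

lemma sin_cos_pos: "0 < sin \<alpha>" "0 < cos \<alpha>"
  using sin_search_angle_pos[OF N] cos_search_angle_pos[OF N] by (auto simp: \<alpha>_def)

text \<open>The normalization \<open>sqrt (N / (N - 1))\<close> is \<open>1 / sin \<alpha>\<close>,
  so this is a Gram-Schmidt step in the plane of the two states.\<close>

lemma marked_perp_eq: "marked_perp e m = (1 / sin \<alpha>) *\<^sub>R (uniform_state e - cos \<alpha> *\<^sub>R e m)"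
  unfolding marked_perp_def \<alpha>_def sin_search_angle[OF N] cos_search_angle[OF N]
  by (simp add: N_def real_sqrt_divide)

lemma uniform_state_eq: "uniform_state e = cos \<alpha> *\<^sub>R e m + sin \<alpha> *\<^sub>R marked_perp e m"
  unfolding marked_perp_eq using sin_cos_pos by simp

lemma braket_marked_perp: "braket (e m) (marked_perp e m) = 0"
  by (simp add: marked_perp_eq braket_simps braket_basis_uniform braket_marked_marked)

lemma braket_perp_marked: "braket (marked_perp e m) (e m) = 0"
  using braket_commute[of "marked_perp e m" "e m"] by (simp add: braket_marked_perp)

lemma braket_perp_uniform: "braket (marked_perp e m) (uniform_state e) = of_real (sin \<alpha>)"
proof -
  have "braket (marked_perp e m) (uniform_state e) = of_real (1 / sin \<alpha> * (1 - cos \<alpha> * cos \<alpha>))"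
    by (simp add: marked_perp_eq braket_simps braket_basis_uniform braket_uniform_uniform)
  also have "1 / sin \<alpha> * (1 - cos \<alpha> * cos \<alpha>) = sin \<alpha>"
    using sin_cos_pos sin_cos_squared_add[of \<alpha>] by (simp add: field_simps power2_eq_square)
  finally show ?thesis .
qed

lemma braket_perp_perp: "braket (marked_perp e m) (marked_perp e m) = 1"
  by (subst (2) marked_perp_eq)
    (use sin_cos_pos in \<open>simp add: braket_simps braket_perp_uniform braket_perp_marked\<close>)

text \<open>Half the mixing angle is \<open>pi / 2 - \<alpha> * (1 - s)\<close>, which swaps sine
  and cosine. The ground state thus rotates at constant speed \<alpha> from the uniform to the
  marked state.\<close>

lemma phi0_tan_interpolation:
  assumes "s \<in> {0..1}"
  shows "phi0 e m (tan_interpolation N) s = cos (\<alpha> * (1 - s)) *\<^sub>R e m + sin (\<alpha> * (1 - s)) *\<^sub>R marked_perp e m"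
  using mixing_angle_tan_interpolation[OF N assms]
  by (simp add: phi0_def N_def[symmetric] \<alpha>_def[symmetric] diff_divide_distrib sin_diff cos_diff)

lemma phi1_tan_interpolation:
  assumes "s \<in> {0..1}"
  shows "phi1 e m (tan_interpolation N) s = sin (\<alpha> * (1 - s)) *\<^sub>R e m - cos (\<alpha> * (1 - s)) *\<^sub>R marked_perp e m"
  using mixing_angle_tan_interpolation[OF N assms]
  by (simp add: phi1_def N_def[symmetric] \<alpha>_def[symmetric] diff_divide_distrib sin_diff cos_diff)

lemma phi0_has_vector_derivative:
  assumes s: "s \<in> {0..1}"
  shows "(phi0 e m (tan_interpolation N) has_vector_derivative \<alpha> *\<^sub>R phi1 e m (tan_interpolation N) s) (at s within {0..1})"
\<comment> \<open>The closed form is known only on [0,1], so the derivative is transferred within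
  that interval.\<close>
proof (rule has_vector_derivative_transform[OF s phi0_tan_interpolation])
  show "((\<lambda>s. cos (\<alpha> * (1 - s)) *\<^sub>R e m + sin (\<alpha> * (1 - s)) *\<^sub>R marked_perp e m)
      has_vector_derivative \<alpha> *\<^sub>R phi1 e m (tan_interpolation N) s) (at s within {0..1})"
    unfolding phi1_tan_interpolation[OF s]
    by (rule has_vector_derivative_eq_rhs, (rule derivative_intros)+)
      (auto intro!: derivative_eq_intros simp: algebra_simps)
qed

lemma coupling_tan_interpolation:
  assumes s: "s \<in> {0..1}"
  shows "coupling e m (tan_interpolation N) s = of_real \<alpha>"
proof -
  have "vector_derivative (phi0 e m (tan_interpolation N)) (at s within {0..1}) = \<alpha> *\<^sub>R phi1 e m (tan_interpolation N) s"
    using phi0_has_vector_derivative[OF s] s by (intro vector_derivative_within_closed_interval) auto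
  moreover have "braket (phi1 e m (tan_interpolation N) s) (phi1 e m (tan_interpolation N) s)
      = of_real ((sin (\<alpha> * (1 - s)))\<^sup>2 + (cos (\<alpha> * (1 - s)))\<^sup>2)"
    unfolding phi1_tan_interpolation[OF s]
    by (simp only: braket_simps braket_marked_marked braket_perp_perp braket_marked_perp
        braket_perp_marked) (simp add: power2_eq_square)
  ultimately show ?thesis by (simp add: coupling_def braket_scaleR_right)
qed

lemma lambda10_tan_interpolation:
  assumes s: "s \<in> {0..1}"
  shows "lambda10 e m (tan_interpolation N) s = of_real (\<alpha> * cos ((2 * s - 1) * \<alpha>) / cos \<alpha>)"
  using coupling_tan_interpolation[OF s] gap_tan_interpolation[OF N s]
  by (simp add: lambda10_def N_def \<alpha>_def)

lemma lambda10_final: "lambda10 e m (tan_interpolation N) 1 = of_real \<alpha>"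
  using lambda10_tan_interpolation[of 1] sin_cos_pos by simp

lemma vector_derivative_lambda10_final:
  "vector_derivative (lambda10 e m (tan_interpolation N)) (at 1 within {0..1})
     = of_real (- 2 * \<alpha>\<^sup>2 * tan \<alpha>)"
proof (rule vector_derivative_within_closed_interval)
  have "((\<lambda>s. \<alpha> * cos ((2 * s - 1) * \<alpha>) / cos \<alpha>) has_real_derivative - 2 * \<alpha>\<^sup>2 * tan \<alpha>)
      (at 1 within {0..1})"
    using sin_cos_pos by (auto intro!: derivative_eq_intros simp: tan_def power2_eq_square)
  hence "((\<lambda>s. of_real (\<alpha> * cos ((2 * s - 1) * \<alpha>) / cos \<alpha>) :: complex) has_vector_derivative
      of_real (- 2 * \<alpha>\<^sup>2 * tan \<alpha>)) (at 1 within {0..1})"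
    by (rule has_vector_derivative_of_real)
  thus "(lambda10 e m (tan_interpolation N) has_vector_derivative of_real (- 2 * \<alpha>\<^sup>2 * tan \<alpha>))
      (at 1 within {0..1})"
    by (rule has_vector_derivative_transform[rotated 2])
      (auto simp: lambda10_tan_interpolation simp del: of_real_mult of_real_divide)
qed auto

lemma J0_final_tan_interpolation: "J0_final e m (tan_interpolation N) = \<alpha> * tan \<alpha>"
proof -
  have "((\<lambda>s. \<alpha>\<^sup>2 * cos ((2 * s - 1) * \<alpha>) / cos \<alpha>) has_integral
      \<alpha> / (2 * cos \<alpha>) * sin ((2 * 1 - 1) * \<alpha>) - \<alpha> / (2 * cos \<alpha>) * sin ((2 * 0 - 1) * \<alpha>)) {0..1}"
    by (rule fundamental_theorem_of_calculus)
      (use sin_cos_pos in \<open>auto intro!: derivative_eq_intros simp: has_real_derivative_iff_has_vector_derivative[symmetric]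
        power2_eq_square\<close>)
  also have "\<alpha> / (2 * cos \<alpha>) * sin ((2 * 1 - 1) * \<alpha>) - \<alpha> / (2 * cos \<alpha>) * sin ((2 * 0 - 1) * \<alpha>)
      = \<alpha> * tan \<alpha>"
    by (simp add: tan_def)
  finally have "((\<lambda>s. (cmod (coupling e m (tan_interpolation N) s))\<^sup>2 / gap N (tan_interpolation N) s)
      has_integral \<alpha> * tan \<alpha>) {0..1}"
    by (rule has_integral_eq[rotated])
      (simp add: coupling_tan_interpolation gap_tan_interpolation[OF N] \<alpha>_def[symmetric])
  thus ?thesis unfolding J0_final_def N_def[symmetric] by (rule integral_unique)
qed

text \<open>The logarithmic derivative of \<open>lambda10\<close> at 1 is
  \<open>- 2 * \<alpha> * tan \<alpha>\<close>, minus twice \<open>J0_final\<close>. The sum is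
  therefore \<open>- \<alpha> * tan \<alpha>\<close>, and the modulus removes the sign.\<close>

lemma validity_time_tan_interpolation:
  "validity_time hbar E C e m (tan_interpolation N) = hbar / E * C * (\<alpha> * tan \<alpha>)"
proof -
  have \<alpha>: "\<alpha> > 0" using search_angle_bounds[OF N] by (simp add: \<alpha>_def)
  have "of_real (J0_final e m (tan_interpolation N)) +
      vector_derivative (lambda10 e m (tan_interpolation N)) (at 1 within {0..1}) /
        lambda10 e m (tan_interpolation N) 1 = of_real (- (\<alpha> * tan \<alpha>))"
    unfolding lambda10_final vector_derivative_lambda10_final J0_final_tan_interpolation
    using \<alpha> by (simp add: power2_eq_square)
  moreover have "\<alpha> * tan \<alpha> > 0"
    using \<alpha> sin_cos_pos by (simp add: tan_def)
  ultimately show ?thesis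
    unfolding validity_time_def by (simp only: norm_of_real abs_minus_cancel abs_of_pos)
qed

end

section \<open>Time evolution\<close>

text \<open>\<open>(hx, hy)\<close> is the scaled Hamiltonian applied to amplitudes
  \<open>(x, y)\<close> along the marked state and its perpendicular. Pairing with the eigenvectors
  \<open>(c, d)\<close> and \<open>(d, -c)\<close> yields the eigenvalues (1 - \<Delta>)/2 and (1 +
  \<Delta>)/2 with \<open>\<Delta> = ca / q\<close>. Clearing the denominators leaves polynomial
  identities.\<close>

lemma avoided_crossing_eigenvectors:
  fixes q c d ca sa x y :: complex
  assumes "q \<noteq> 0" and "q = ca * (c\<^sup>2 - d\<^sup>2) + 2 * sa * c * d" and "c\<^sup>2 + d\<^sup>2 = 1"
  defines "hx \<equiv> c * d / q * (sa * x - ca * y)"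
    and "hy \<equiv> y - c * d / q * (ca * x + sa * y)"
  shows "c * hx + d * hy = (1 - ca / q) / 2 * (c * x + d * y)"
    and "d * hx - c * hy = (1 + ca / q) / 2 * (d * x - c * y)"
proof -
  have "2 * (c * (c * d * (sa * x - ca * y)) + d * (y * q - c * d * (ca * x + sa * y)))
      = (q - ca) * (c * x + d * y)"
    using assms(2,3) by algebra
  thus "c * hx + d * hy = (1 - ca / q) / 2 * (c * x + d * y)"
    unfolding hx_def hy_def using assms(1) by (simp add: divide_simps) (simp add: algebra_simps)
  have "2 * (d * (c * d * (sa * x - ca * y)) - c * (y * q - c * d * (ca * x + sa * y)))
      = (q + ca) * (d * x - c * y)"
    using assms(2,3) by algebra
  thus "d * hx - c * hy = (1 + ca / q) / 2 * (d * x - c * y)"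
    unfolding hx_def hy_def using assms(1) by (simp add: divide_simps) (simp add: algebra_simps)
qed

context
  fixes e :: "'n::finite \<Rightarrow> complex ^ 'n" and m :: 'n and N :: nat and \<alpha> :: real
    and E hbar T :: real and \<psi> :: "real \<Rightarrow> complex ^ 'n"
  defines "N \<equiv> CARD('n)" and "\<alpha> \<equiv> search_angle N"
  assumes basis: "orthonormal_basis e" and N: "N \<ge> 2"
    and pos: "E > 0" "hbar > 0" "T > 0"
    and sol: "schroedinger_solution hbar T (search_hamiltonian E e m (tan_interpolation N)) \<psi>"
begin

lemma braket_evolution:
  assumes "s \<in> {0..1}"
  shows "((\<lambda>s. braket v (\<psi> s)) has_vector_derivative
    - \<i> * of_real (T * E / hbar) *
      (of_real (1 - tan_interpolation N s) *
        (braket v (\<psi> s) - braket (uniform_state e) (\<psi> s) * braket v (uniform_state e)) +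
       of_real (tan_interpolation N s) * (braket v (\<psi> s) - braket (e m) (\<psi> s) * braket v (e m))))
    (at s within {0..1})"
proof -
  obtain D where D: "(\<psi> has_vector_derivative D) (at s within {0..1})"
    and eq: "(\<i> * of_real (hbar / T)) *s D = search_hamiltonian E e m (tan_interpolation N) s *v \<psi> s"
    using sol assms unfolding schroedinger_solution_def by blast
  have "\<i> * of_real (hbar / T) * braket v D = of_real E * (of_real (1 - tan_interpolation N s) *
        (braket v (\<psi> s) - braket (uniform_state e) (\<psi> s) * braket v (uniform_state e)) +
       of_real (tan_interpolation N s) * (braket v (\<psi> s) - braket (e m) (\<psi> s) * braket v (e m)))"
    (is "_ = of_real E * ?h")
    using arg_cong[OF eq, of "braket v"]
    unfolding search_hamiltonian_mult_vec by (simp only: braket_simps)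
  hence "braket v D = of_real E * ?h / (\<i> * of_real (hbar / T))"
    using pos by (simp add: field_simps)
  also have "\<dots> = - \<i> * of_real (T * E / hbar) * ?h"
    using pos by (simp add: field_simps)
  finally have "braket v D = - \<i> * of_real (T * E / hbar) * ?h" .
  with bounded_linear.has_vector_derivative[OF bounded_linear_braket D, of v] show ?thesis
    by simp
qed

text \<open>The uniform state lies in the plane of the marked state and its perpendicular, so these
  two amplitudes form a closed system. The schedule enters only through
  \<open>(1 - f) * sin \<alpha>\<close>, which is \<open>c * d / q\<close> by the double-angle
  formula.\<close>

lemma marked_plane_evolution:
  fixes c d q :: "real \<Rightarrow> complex" and x y :: "real \<Rightarrow> complex"
  defines "c \<equiv> \<lambda>s. of_real (cos (\<alpha> * (1 - s)))" and "d \<equiv> \<lambda>s. of_real (sin (\<alpha> * (1 - s)))"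
    and "q \<equiv> \<lambda>s. of_real (cos ((2 * s - 1) * \<alpha>))"
    and "x \<equiv> \<lambda>s. braket (e m) (\<psi> s)" and "y \<equiv> \<lambda>s. braket (marked_perp e m) (\<psi> s)"
  assumes s: "s \<in> {0..1}"
  shows "(x has_vector_derivative - \<i> * of_real (T * E / hbar) *
            (c s * d s / q s * (of_real (sin \<alpha>) * x s - of_real (cos \<alpha>) * y s))) (at s within {0..1})"
    and "(y has_vector_derivative - \<i> * of_real (T * E / hbar) *
            (y s - c s * d s / q s * (of_real (cos \<alpha>) * x s + of_real (sin \<alpha>) * y s)))
          (at s within {0..1})"
proof -
  define g :: complex where "g = of_real (1 - tan_interpolation N s)"
  have sin_pos: "sin \<alpha> > 0" using sin_search_angle_pos[OF N] by (simp add: \<alpha>_def)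
  have q: "cos ((2 * s - 1) * \<alpha>) > 0"
    using cos_scaled_angle_pos[OF N s] by (simp add: \<alpha>_def)
  have "(1 - tan_interpolation N s) * sin \<alpha>
      = cos (\<alpha> * (1 - s)) * sin (\<alpha> * (1 - s)) / cos ((2 * s - 1) * \<alpha>)"
  proof -
    have "\<alpha> - (2 * s - 1) * \<alpha> = 2 * (\<alpha> * (1 - s))" by (simp add: algebra_simps)
    hence "sin (\<alpha> - (2 * s - 1) * \<alpha>) = 2 * sin (\<alpha> * (1 - s)) * cos (\<alpha> * (1 - s))"
      by (simp only: sin_double)
    thus ?thesis
      unfolding one_minus_tan_interpolation_eq[OF N s] \<alpha>_def[symmetric] using sin_pos by simp
  qed
  from arg_cong[OF this, of complex_of_real]
  have g: "g * of_real (sin \<alpha>) = c s * d s / q s"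
    unfolding c_def d_def q_def g_def of_real_mult of_real_divide .
  have f: "of_real (tan_interpolation N s) = 1 - g" by (simp add: g_def)
  have "sin \<alpha> * sin \<alpha> + cos \<alpha> * cos \<alpha> = 1"
    using sin_cos_squared_add[of \<alpha>] by (simp add: power2_eq_square)
  from arg_cong[OF this, of complex_of_real]
  have sc: "of_real (sin \<alpha>) * of_real (sin \<alpha>) + of_real (cos \<alpha>) * of_real (cos \<alpha>) = (1::complex)"
    by simp
  note bk = braket_basis_uniform[OF basis N[unfolded N_def], folded N_def \<alpha>_def]
    braket_perp_uniform[OF basis N[unfolded N_def], folded N_def \<alpha>_def]
    braket_perp_marked[OF basis N[unfolded N_def]] braket_marked_marked[OF basis N[unfolded N_def]]
  have S: "braket (uniform_state e) (\<psi> s) = of_real (cos \<alpha>) * x s + of_real (sin \<alpha>) * y s"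
    unfolding x_def y_def
    by (subst uniform_state_eq[OF basis N[unfolded N_def], folded N_def \<alpha>_def, of m])
       (simp only: braket_simps)
  have xs: "braket (e m) (\<psi> s) = x s" "braket (marked_perp e m) (\<psi> s) = y s"
    by (simp_all add: x_def y_def)
  have hx: "g * (x s - (of_real (cos \<alpha>) * x s + of_real (sin \<alpha>) * y s) * of_real (cos \<alpha>))
        + (1 - g) * (x s - x s * 1)
      = c s * d s / q s * (of_real (sin \<alpha>) * x s - of_real (cos \<alpha>) * y s)"
    unfolding g[symmetric] using sc by algebra
  have hy: "g * (y s - (of_real (cos \<alpha>) * x s + of_real (sin \<alpha>) * y s) * of_real (sin \<alpha>))
        + (1 - g) * (y s - x s * 0)
      = y s - c s * d s / q s * (of_real (cos \<alpha>) * x s + of_real (sin \<alpha>) * y s)"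
    unfolding g[symmetric] by (simp add: algebra_simps)
  show "(x has_vector_derivative - \<i> * of_real (T * E / hbar) *
            (c s * d s / q s * (of_real (sin \<alpha>) * x s - of_real (cos \<alpha>) * y s))) (at s within {0..1})"
    using braket_evolution[OF s, of "e m"]
    unfolding bk S f xs g_def[symmetric] hx x_def[symmetric] .
  show "(y has_vector_derivative - \<i> * of_real (T * E / hbar) *
            (y s - c s * d s / q s * (of_real (cos \<alpha>) * x s + of_real (sin \<alpha>) * y s)))
          (at s within {0..1})"
    using braket_evolution[OF s, of "marked_perp e m"]
    unfolding bk S f xs g_def[symmetric] hy y_def[symmetric] .
qed

text \<open>\<open>a\<close> and \<open>b\<close> are the amplitudes along \<open>phi0\<close> and
  \<open>phi1\<close>. The rotation of this frame at speed \<alpha> gives the off-diagonal terms;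
  the Hamiltonian contributes only the eigenvalues.\<close>

lemma eigenbasis_evolution:
  fixes c d a b :: "real \<Rightarrow> complex"
  defines "c \<equiv> \<lambda>s. of_real (cos (\<alpha> * (1 - s)))" and "d \<equiv> \<lambda>s. of_real (sin (\<alpha> * (1 - s)))"
    and "a \<equiv> \<lambda>s. c s * braket (e m) (\<psi> s) + d s * braket (marked_perp e m) (\<psi> s)"
    and "b \<equiv> \<lambda>s. d s * braket (e m) (\<psi> s) - c s * braket (marked_perp e m) (\<psi> s)"
  assumes s: "s \<in> {0..1}"
  defines "\<Delta> \<equiv> cos \<alpha> / cos ((2 * s - 1) * \<alpha>)"
  shows "(a has_vector_derivative of_real \<alpha> * b s
      - \<i> * of_real (T * E / hbar) * ((1 - of_real \<Delta>) / 2 * a s)) (at s within {0..1})"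
    and "(b has_vector_derivative - of_real \<alpha> * a s
      - \<i> * of_real (T * E / hbar) * ((1 + of_real \<Delta>) / 2 * b s)) (at s within {0..1})"
proof -
  define k where "k = - \<i> * of_real (T * E / hbar)"
  define x where "x = (\<lambda>s. braket (e m) (\<psi> s))"
  define y where "y = (\<lambda>s. braket (marked_perp e m) (\<psi> s))"
  define q :: complex where "q = of_real (cos ((2 * s - 1) * \<alpha>))"
  define hx where "hx = c s * d s / q * (of_real (sin \<alpha>) * x s - of_real (cos \<alpha>) * y s)"
  define hy where "hy = y s - c s * d s / q * (of_real (cos \<alpha>) * x s + of_real (sin \<alpha>) * y s)"
  have dx: "(x has_vector_derivative k * hx) (at s within {0..1})"
    and dy: "(y has_vector_derivative k * hy) (at s within {0..1})"
    using marked_plane_evolution[OF s]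
    unfolding x_def y_def hx_def hy_def k_def c_def d_def q_def by blast+
  have dc: "(c has_vector_derivative of_real \<alpha> * d s) (at s within {0..1})"
  proof -
    have "((\<lambda>s. cos (\<alpha> * (1 - s))) has_real_derivative \<alpha> * sin (\<alpha> * (1 - s))) (at s within {0..1})"
      by (auto intro!: derivative_eq_intros)
    from has_vector_derivative_of_real[OF this] show ?thesis by (simp add: c_def d_def)
  qed
  have dd: "(d has_vector_derivative - of_real \<alpha> * c s) (at s within {0..1})"
  proof -
    have "((\<lambda>s. sin (\<alpha> * (1 - s))) has_real_derivative - \<alpha> * cos (\<alpha> * (1 - s))) (at s within {0..1})"
      by (auto intro!: derivative_eq_intros)
    from has_vector_derivative_of_real[OF this] show ?thesis by (simp add: c_def d_def)
  qed
  have a: "a = (\<lambda>s. c s * x s + d s * y s)" and b: "b = (\<lambda>s. d s * x s - c s * y s)"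
    by (auto simp: a_def b_def x_def y_def)
  have q0: "q \<noteq> 0" using cos_scaled_angle_pos[OF N s] by (simp add: q_def \<alpha>_def)
  have cd: "(c s)\<^sup>2 + (d s)\<^sup>2 = 1"
    using arg_cong[OF sin_cos_squared_add2[of "\<alpha> * (1 - s)"], of complex_of_real]
    unfolding c_def d_def of_real_add of_real_power of_real_1 .
  \<comment> \<open>With \<open>u = \<alpha> - 2 * (\<alpha> * (1 - s))\<close>, the addition and
    double-angle formulas express \<open>cos u\<close> through \<open>c\<close> and
    \<open>d\<close>.\<close>
  have qq: "q = of_real (cos \<alpha>) * ((c s)\<^sup>2 - (d s)\<^sup>2) + 2 * of_real (sin \<alpha>) * c s * d s"
  proof -
    have "(2 * s - 1) * \<alpha> = \<alpha> - 2 * (\<alpha> * (1 - s))" by (simp add: algebra_simps)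
    hence "cos ((2 * s - 1) * \<alpha>) = cos \<alpha> * ((cos (\<alpha> * (1 - s)))\<^sup>2 - (sin (\<alpha> * (1 - s)))\<^sup>2)
        + 2 * sin \<alpha> * cos (\<alpha> * (1 - s)) * sin (\<alpha> * (1 - s))"
      by (simp only: cos_diff cos_double sin_double) simp
    from arg_cong[OF this, of complex_of_real] show ?thesis by (simp add: q_def c_def d_def)
  qed
  have \<Delta>: "of_real \<Delta> = of_real (cos \<alpha>) / q" by (simp add: \<Delta>_def q_def)
  note eig = avoided_crossing_eigenvectors[OF q0 qq cd, of "x s" "y s", folded hx_def hy_def, folded \<Delta>]
  have "(a has_vector_derivative of_real \<alpha> * b s + k * (c s * hx + d s * hy)) (at s within {0..1})"
    unfolding a b
    by (rule has_vector_derivative_eq_rhs[OF has_vector_derivative_add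
          [OF has_vector_derivative_mult[OF dc dx] has_vector_derivative_mult[OF dd dy]]])
       (simp add: algebra_simps)
  thus "(a has_vector_derivative of_real \<alpha> * b s
      - \<i> * of_real (T * E / hbar) * ((1 - of_real \<Delta>) / 2 * a s)) (at s within {0..1})"
    unfolding eig(1) by (simp add: k_def a)
  have "(b has_vector_derivative - of_real \<alpha> * a s + k * (d s * hx - c s * hy)) (at s within {0..1})"
    unfolding a b
    by (rule has_vector_derivative_eq_rhs[OF has_vector_derivative_diff
          [OF has_vector_derivative_mult[OF dd dx] has_vector_derivative_mult[OF dc dy]]])
       (simp add: algebra_simps)
  thus "(b has_vector_derivative - of_real \<alpha> * a s
      - \<i> * of_real (T * E / hbar) * ((1 + of_real \<Delta>) / 2 * b s)) (at s within {0..1})"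
    unfolding eig(2) by (simp add: k_def b)
qed

text \<open>The witness is the modulus of the excited amplitude at \<open>s = 1\<close>, where the
  ground state is the marked one. Norm conservation gives the quadratic relation, and
  \<open>two_level_transition_bound\<close> the estimate.\<close>

lemma search_transition_bound:
  assumes init: "\<psi> 0 = uniform_state e"
  defines "\<kappa> \<equiv> T * E / hbar"
    and "M \<equiv> max 1 (4 * \<alpha>\<^sup>2) / cos \<alpha>"
  obtains b where "0 \<le> b" "(cmod (braket (e m) (\<psi> 1)))\<^sup>2 + b\<^sup>2 = 1"
    and "b \<le> 2 * \<alpha> / \<kappa> + \<alpha> * M\<^sup>2 * (\<alpha>\<^sup>2 * (3 + \<alpha>) + 4 + \<alpha>) / \<kappa>\<^sup>2"
proof -
  define c :: "real \<Rightarrow> complex" where "c = (\<lambda>s. of_real (cos (\<alpha> * (1 - s))))"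
  define d :: "real \<Rightarrow> complex" where "d = (\<lambda>s. of_real (sin (\<alpha> * (1 - s))))"
  define a where "a = (\<lambda>s. c s * braket (e m) (\<psi> s) + d s * braket (marked_perp e m) (\<psi> s))"
  define b where "b = (\<lambda>s. d s * braket (e m) (\<psi> s) - c s * braket (marked_perp e m) (\<psi> s))"
  define p where "p = (\<lambda>s. cos ((2 * s - 1) * \<alpha>) / cos \<alpha>)"
  define p1 where "p1 = (\<lambda>s. - 2 * \<alpha> * sin ((2 * s - 1) * \<alpha>) / cos \<alpha>)"
  define p2 where "p2 = (\<lambda>s. - 4 * \<alpha>\<^sup>2 * cos ((2 * s - 1) * \<alpha>) / cos \<alpha>)"
  have \<alpha>: "\<alpha> > 0" using search_angle_bounds[OF N] by (simp add: \<alpha>_def)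
  have cos_pos: "cos \<alpha> > 0" using cos_search_angle_pos[OF N] by (simp add: \<alpha>_def)
  have \<kappa>: "\<kappa> > 0" using pos by (simp add: \<kappa>_def)
  have p_pos: "p s > 0" if "s \<in> {0..1}" for s
    using cos_scaled_angle_pos[OF N that] cos_pos by (simp add: p_def \<alpha>_def)
  have ab: "(a has_vector_derivative of_real \<alpha> * b s
        - \<i> * of_real \<kappa> * ((1 - of_real (1 / p s)) / 2 * a s)) (at s within {0..1})"
      "(b has_vector_derivative - of_real \<alpha> * a s
        - \<i> * of_real \<kappa> * ((1 + of_real (1 / p s)) / 2 * b s)) (at s within {0..1})"
    if s: "s \<in> {0..1}" for s
    using eigenbasis_evolution[OF s] unfolding a_def b_def c_def d_def p_def \<kappa>_def by simp_all
  \<comment> \<open>The phase \<open>P\<close> removes the excited energy, leaving only the gap \<open>1 / p\<close> in the ground amplitude.\<close>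
  define w where "w = (\<lambda>s. (1 + 1 / p s) / 2)"
  define W where "W = (\<lambda>s. integral {0..s} w)"
  define P :: "real \<Rightarrow> complex" where "P = (\<lambda>s. exp (\<i> * of_real (\<kappa> * W s)))"
  have dP: "(P has_vector_derivative \<i> * of_real (\<kappa> * w s) * P s) (at s within {0..1})"
    if s: "s \<in> {0..1}" for s
  proof -
    have "p s \<noteq> 0" if "s \<in> {0..1}" for s using p_pos[OF that] by simp
    hence "continuous_on {0..1} w"
      unfolding w_def using cos_pos by (auto simp: p_def intro!: continuous_intros)
    from integral_has_vector_derivative[OF this s]
    have "((\<lambda>s. of_real (\<kappa> * W s)) has_vector_derivative complex_of_real (\<kappa> * w s)) (at s within {0..1})"
      unfolding W_def
      by (intro has_vector_derivative_of_real DERIV_cmult)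
         (simp add: has_real_derivative_iff_has_vector_derivative)
    hence "((\<lambda>s. \<i> * of_real (\<kappa> * W s)) has_vector_derivative \<i> * of_real (\<kappa> * w s)) (at s within {0..1})"
      by (rule has_vector_derivative_mult_right)
    from field_vector_diff_chain_within[OF this, of exp "exp (\<i> * of_real (\<kappa> * W s))"]
    show ?thesis by (simp add: P_def o_def DERIV_exp has_field_derivative_at_within)
  qed
  have P1: "cmod (P s) = 1" for s by (simp add: P_def)
  have dB: "((\<lambda>s. b s * P s) has_vector_derivative - of_real \<alpha> * (a s * P s)) (at s within {0..1})"
    if s: "s \<in> {0..1}" for s
    by (rule has_vector_derivative_eq_rhs[OF has_vector_derivative_mult[OF ab(2)[OF s] dP[OF s]]])
         (simp add: w_def algebra_simps add_divide_distrib)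
  have dG: "((\<lambda>s. a s * P s) has_vector_derivative of_real \<alpha> * (b s * P s) +
        \<i> * of_real (\<kappa> / p s) * (a s * P s)) (at s within {0..1})"
    if s: "s \<in> {0..1}" for s
    by (rule has_vector_derivative_eq_rhs[OF has_vector_derivative_mult[OF ab(1)[OF s] dP[OF s]]])
         (simp add: w_def field_simps)
  \<comment> \<open>At \<open>s = 0\<close> the vector \<open>phi0\<close> is the uniform state, so
    all of the initial norm sits in \<open>a\<close>.\<close>
  have start: "b 0 * P 0 = 0" "cmod (a 0 * P 0) = 1"
  proof -
    have N': "CARD('n) \<ge> 2" using N by (simp add: N_def)
    note start = braket_basis_uniform[OF basis N', folded N_def \<alpha>_def]
      braket_perp_uniform[OF basis N', folded N_def \<alpha>_def]
    show "b 0 * P 0 = 0" by (simp add: b_def c_def d_def init start)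
    have "a 0 = of_real ((cos \<alpha>)\<^sup>2 + (sin \<alpha>)\<^sup>2)"
      unfolding a_def c_def d_def init start
      by (simp add: power2_eq_square del: sin_cos_squared_add sin_cos_squared_add2 sin_cos_squared_add3)
    also have "(cos \<alpha>)\<^sup>2 + (sin \<alpha>)\<^sup>2 = 1" by simp
    finally show "cmod (a 0 * P 0) = 1" by (simp add: norm_mult P1)
  qed
  have "cmod (b 1 * P 1) \<le> 2 * \<alpha> / \<kappa> + \<alpha> * M\<^sup>2 * (\<alpha>\<^sup>2 * (3 + \<alpha>) + 4 + \<alpha>) / \<kappa>\<^sup>2"
  proof (rule two_level_transition_bound[where B = "\<lambda>s. b s * P s" and G = "\<lambda>s. a s * P s"
        and p = p and ?p1.0 = p1 and ?p2.0 = p2])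
    fix s :: real assume s: "s \<in> {0..1}"
    show "((\<lambda>s. b s * P s) has_vector_derivative - of_real \<alpha> * (a s * P s)) (at s within {0..1})"
      "((\<lambda>s. a s * P s) has_vector_derivative of_real \<alpha> * (b s * P s) +
        \<i> * of_real (\<kappa> / p s) * (a s * P s)) (at s within {0..1})"
      by (fact dB[OF s] dG[OF s])+
    show "(p has_real_derivative p1 s) (at s within {0..1})"
      "(p1 has_real_derivative p2 s) (at s within {0..1})"
      unfolding p_def p1_def p2_def using cos_pos
      by (auto intro!: derivative_eq_intros simp: power2_eq_square)
    show "p s > 0" by (rule p_pos[OF s])
    have M1: "1 \<le> M * cos \<alpha>" "4 * \<alpha>\<^sup>2 \<le> M * cos \<alpha>" using cos_pos by (simp_all add: M_def)
    \<comment> \<open>The maximum of 1 and \<open>(2 * \<alpha>)\<^sup>2\<close> also dominates the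
      intermediate power \<open>2 * \<alpha>\<close>, so one \<open>M\<close> serves
      \<open>p\<close>, \<open>p1\<close> and \<open>p2\<close>.\<close>
    have M2: "2 * \<alpha> \<le> M * cos \<alpha>"
    proof (cases "2 * \<alpha> \<le> 1")
      case False
      hence "2 * \<alpha> \<le> (2 * \<alpha>) * (2 * \<alpha>)" by (simp add: mult_le_cancel_left1)
      thus ?thesis using M1(2) by (simp add: power2_eq_square)
    qed (use M1 in simp)
    have scale: "\<bar>r * t / cos \<alpha>\<bar> \<le> M" if "\<bar>t\<bar> \<le> 1" "\<bar>r\<bar> \<le> M * cos \<alpha>" for r t
      using mult_mono[OF that(2,1)] that cos_pos M1
      by (simp add: abs_mult pos_divide_le_eq)
    have "\<bar>1 * cos ((2 * s - 1) * \<alpha>) / cos \<alpha>\<bar> \<le> M" using M1 by (intro scale) auto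
    thus "p s \<le> M" unfolding p_def mult_1 by (rule abs_le_D1)
    show "\<bar>p1 s\<bar> \<le> M" unfolding p1_def using M2 \<alpha> by (intro scale) auto
    show "\<bar>p2 s\<bar> \<le> M" unfolding p2_def using M1 by (intro scale) auto
  qed (use \<alpha> \<kappa> cos_pos start in \<open>auto simp: p_def\<close>)
  hence b_le: "cmod (b 1) \<le> 2 * \<alpha> / \<kappa> + \<alpha> * M\<^sup>2 * (\<alpha>\<^sup>2 * (3 + \<alpha>) + 4 + \<alpha>) / \<kappa>\<^sup>2"
    by (simp add: norm_mult P1)
  show thesis
  proof (rule that[OF norm_ge_zero _ b_le])
    show "(cmod (braket (e m) (\<psi> 1)))\<^sup>2 + (cmod (b 1))\<^sup>2 = 1"
      using two_level_norm_conserved[where B = "\<lambda>s. b s * P s" and G = "\<lambda>s. a s * P s"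
          and s = 1, OF dB dG] start
      by (simp add: norm_mult P1 a_def c_def d_def)
  qed
qed

end

section \<open>From the transition bound to the error estimate and the validity quantities\<close>

theorem mainTheorem5:
  fixes N :: nat and hbar E :: real
    and e :: "'n::finite \<Rightarrow> complex ^ 'n" and m :: 'n
  assumes "N = CARD('n)" and "N \<ge> 2" and "hbar > 0" and "E > 0"
    and "orthonormal_basis e"
  shows "(\<forall>\<Psi> :: real \<Rightarrow> real \<Rightarrow> complex ^ 'n.
            (\<forall>T>0. schroedinger_solution hbar T
                     (search_hamiltonian E e m (tan_interpolation N)) (\<lambda>s. \<Psi> s T) \<and>
                   \<Psi> 0 T = uniform_state e) \<longrightarrow>
            (\<exists>r \<in> O[at_top](\<lambda>T. 1 / T\<^sup>2). \<forall>T>0.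
               arccos (cmod (braket (e m) (\<Psi> 1 T)))
                 \<le> hbar / (E * T) * (2 * arccos (1 / sqrt (real N))) + r T)) \<and>
         (\<forall>C>0.
            validity_time hbar E C e m (tan_interpolation N)
              = hbar / E * C * arccos (1 / sqrt (real N)) * sqrt (real N - 1) \<and>
            validity_error hbar E C e m (tan_interpolation N)
              = 2 / (C * sqrt (real N - 1)))"
proof (intro conjI allI impI)
  have N: "CARD('n) \<ge> 2" using assms by simp
  define \<alpha> where "\<alpha> = search_angle N"
  have \<alpha>: "\<alpha> > 0" and arccos: "arccos (1 / sqrt (real N)) = \<alpha>" and tan: "tan \<alpha> = sqrt (real N - 1)"
    using search_angle_bounds[OF assms(2)] arccos_search_angle[OF assms(2)]
      tan_search_angle[OF assms(2)] by (auto simp: \<alpha>_def)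
  {
    fix \<Psi> :: "real \<Rightarrow> real \<Rightarrow> complex ^ 'n"
    assume \<Psi>: "\<forall>T>0. schroedinger_solution hbar T
         (search_hamiltonian E e m (tan_interpolation N)) (\<lambda>s. \<Psi> s T) \<and> \<Psi> 0 T = uniform_state e"
    define M where "M = max 1 (4 * \<alpha>\<^sup>2) / cos \<alpha>"
    define K where "K = \<alpha> * M\<^sup>2 * (\<alpha>\<^sup>2 * (3 + \<alpha>) + 4 + \<alpha>)"
    have K: "K \<ge> 0" unfolding K_def using \<alpha> by (intro mult_nonneg_nonneg add_nonneg_nonneg) auto
    \<comment> \<open>\<open>K\<close> is the second-order constant of the transition bound; the
      other summand is 8, from the \<open>arccos\<close> estimate, times the constant in the bound
      on \<open>b\<^sup>2\<close> below.\<close>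
    define L where "L = K + 8 * (1 + (2 * \<alpha> + K)\<^sup>2)"
    define r where "r = (\<lambda>T. L * (hbar / E)\<^sup>2 * (1 / T\<^sup>2))"
    have "r \<in> O[at_top](\<lambda>T. 1 / T\<^sup>2)" unfolding r_def
      by (rule bigoI[where c = "\<bar>L * (hbar / E)\<^sup>2\<bar>"]) (simp add: abs_mult)
    moreover have "arccos (cmod (braket (e m) (\<Psi> 1 T)))
        \<le> hbar / (E * T) * (2 * arccos (1 / sqrt (real N))) + r T" if T: "T > 0" for T
    proof -
      define \<kappa> where "\<kappa> = T * E / hbar"
      have \<kappa>: "\<kappa> > 0" using T assms by (simp add: \<kappa>_def)
      obtain b where b: "0 \<le> b" "(cmod (braket (e m) (\<Psi> 1 T)))\<^sup>2 + b\<^sup>2 = 1" "b \<le> 2 * \<alpha> / \<kappa> + K / \<kappa>\<^sup>2"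
        using search_transition_bound[OF assms(5) N assms(4,3) T, of m "\<lambda>s. \<Psi> s T"] \<Psi> T
        unfolding K_def M_def \<alpha>_def \<kappa>_def assms(1) by blast
      \<comment> \<open>The estimate is required for every \<open>T > 0\<close>. For
        \<open>\<kappa> \<ge> 1\<close> it follows from the transition bound; for smaller \<kappa>
        the trivial \<open>b\<^sup>2 \<le> 1\<close> suffices, which accounts for the summand
        1.\<close>
      have "b\<^sup>2 \<le> (1 + (2 * \<alpha> + K)\<^sup>2) / \<kappa>\<^sup>2"
      proof (cases "\<kappa> \<ge> 1")
        case True
        hence "K / \<kappa>\<^sup>2 \<le> K / \<kappa>"
          using K \<kappa> by (intro divide_left_mono) (auto simp: power2_eq_square)
        hence "b \<le> (2 * \<alpha> + K) / \<kappa>" using b(3) by (simp add: add_divide_distrib)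
        hence "b\<^sup>2 \<le> ((2 * \<alpha> + K) / \<kappa>)\<^sup>2" using b(1) by (intro power_mono)
        also have "\<dots> \<le> (1 + (2 * \<alpha> + K)\<^sup>2) / \<kappa>\<^sup>2"
          using \<kappa> by (simp add: power_divide divide_right_mono)
        finally show ?thesis .
      next
        case False
        have "b\<^sup>2 \<le> 1" using b(2) zero_le_power2[of "cmod (braket (e m) (\<Psi> 1 T))"] by linarith
        also have "1 \<le> 1 / \<kappa>\<^sup>2" using False \<kappa> power_le_one[of \<kappa> 2] by (simp add: field_simps)
        also have "\<dots> \<le> (1 + (2 * \<alpha> + K)\<^sup>2) / \<kappa>\<^sup>2" by (intro divide_right_mono) auto
        finally show ?thesis .
      qed
      hence "arccos (cmod (braket (e m) (\<Psi> 1 T)))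
          \<le> 2 * \<alpha> / \<kappa> + K / \<kappa>\<^sup>2 + 8 * ((1 + (2 * \<alpha> + K)\<^sup>2) / \<kappa>\<^sup>2)"
        using arccos_le_if_sum_squares_eq_one[OF norm_ge_zero b(1,2)] b(3) by linarith
      also have "\<dots> = 2 * \<alpha> / \<kappa> + L / \<kappa>\<^sup>2" by (simp add: L_def add_divide_distrib)
      also have "2 * \<alpha> / \<kappa> = hbar / (E * T) * (2 * arccos (1 / sqrt (real N)))"
        using T assms(3,4) by (simp add: \<kappa>_def arccos mult_ac)
      also have "L / \<kappa>\<^sup>2 = r T"
        using T assms(3,4) by (simp add: \<kappa>_def r_def power2_eq_square)
      finally show ?thesis .
    qed
    ultimately show "\<exists>r \<in> O[at_top](\<lambda>T. 1 / T\<^sup>2). \<forall>T>0.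
        arccos (cmod (braket (e m) (\<Psi> 1 T)))
          \<le> hbar / (E * T) * (2 * arccos (1 / sqrt (real N))) + r T" by blast
  }
  fix C :: real
  assume C: "C > 0"
  show time: "validity_time hbar E C e m (tan_interpolation N)
      = hbar / E * C * arccos (1 / sqrt (real N)) * sqrt (real N - 1)"
    using validity_time_tan_interpolation[OF assms(5) N, of hbar E C m, folded assms(1) \<alpha>_def]
    unfolding arccos tan[symmetric] by (simp only: mult.assoc)
  \<comment> \<open>The final value of \<open>lambda10\<close> is \<alpha>, which cancels the factor
    \<alpha> of the validity time.\<close>
  show "validity_error hbar E C e m (tan_interpolation N) = 2 / (C * sqrt (real N - 1))"
    unfolding validity_error_def time arccos
      lambda10_final[OF assms(5) N, of m, folded assms(1) \<alpha>_def]
    using \<alpha> C assms(2-4) by (simp add: field_simps)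
qed

end
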